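(* Consider the class $\mathcal{F}_{csc}$ of convex-strongly-convex bilevel problems and the hypergradient-based algorithm class (see context), let $\beta=\frac{\widetilde L_y-\mu_y}{4}$ and $B=\|x^*\|$ for a minimizer $x^*$ of $\Phi$. Suppose $\beta\le\mathcal{O}(\mu_y)$. Then there exists an instance in $\mathcal{F}_{csc}$ with dimensions $p=q=d$ such that, for any algorithm in the hypergradient-based algorithm class, the complexity of achieving $\|\nabla\Phi(x^K)\|\le\epsilon$ satisfies $$\mathcal{C}_{\mathrm{norm}}(\mathcal{A},\epsilon)\ge\Omega\Big(\frac{B^{1/2}(\widetilde L_{xy}^2L_y+L_x\mu_y^2)^{1/2}}{\mu_y\,\epsilon^{1/2}}\Big).$$
   Context: Bilevel problem: minimize $\Phi(x)=f(x,y^*(x))$, $y^*(x)=\arg\min_{y\in\mathbb{R}^q}g(x,y)$, $x\in\mathbb{R}^p$. Class $\mathcal{F}_{csc}$: (a) there are constants $L_x,L_{xy},L_y,\widetilde L_{xy},\widetilde L_y\ge0$ such that $\nabla_x f$ is $L_x$-Lipschitz in $x$ and $L_{xy}$-Lipschitz in $y$, $\nabla_y f$ is $L_{xy}$-Lipschitz in $x$ and $L_y$-Lipschitz in $y$, $\nabla_y g$ is $\widetilde L_{xy}$-Lipschitz in $x$ and $\widetilde L_y$-Lipschitz in $y$; (b) there are $\rho_{xy},\rho_{yy}\ge0$ such that $\nabla_x\nabla_y g$ is $\rho_{xy}$-Lipschitz and $\nabla_y^2 g$ is $\rho_{yy}$-Lipschitz in $(x,y)$; (c) $\|x^*\|=B$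 for some constant $B>0$, where $x^*\in\arg\min\Phi$; (d) $\Phi$ is convex and $g(x,\cdot)$ is $\mu_y$-strongly convex for every $x$. Hypergradient-based algorithm class: there are $K$ iterations in total, and $x$ is updated $Q$ times, at iterations $s_0<\dots<s_{Q-1}\le K$, where $Q$ and the $s_i$ are arbitrary; $T\in\mathbb{N}$ bounds the number of Hessian-vector products per $x$-update. Iterates satisfy $x_k\in\mathcal{H}_x^k$, $y_k\in\mathcal{H}_y^k$ (output $x^K\in\mathcal{H}_x^K$), where $\mathcal{H}_x^0=\mathcal{H}_y^0=\{0\}$, $$\mathcal{H}_y^{k+1}=\mathrm{Span}\{y_i,\nabla_yg(\widetilde x_i,\widetilde y_i):\ \widetilde x_i\in\mathcal{H}_x^i,\ y_i,\widetilde y_i\in\mathcal{H}_y^i,\ 1\le i\le k\},$$ and for $m=0,\dots,Q-1$, $$\mathcal{H}_x^{s_m}=\mathrm{Span}\Big\{x_i,\ \nabla_xf(\widetilde x_i,\widetilde y_i),\ \nabla_x\nabla_yg(x_i^t,y_i^t)\prod_{j=1}^t\big(I-\alpha\nabla_y^2g(x_{i,j}^t,y_{i,j}^t)\big)\nabla_yf(\hat x_i,\hat y_i)\Big\},$$ over $t=0,\dots,T$, $x_i,\widetilde x_i,\hat x_i,x_i^t,x_{i,j}^t\in\mathcal{H}_x^i$, $\widetilde y_i,\hat y_i,y_i^t,y_{i,j}^t\in\mathcal{H}_y^i$, $1\le i\le s_m-1$, $\alpha\in\mathbb{R}$; and $\mathcal{H}_x^n=\mathcal{H}_x^{s_m}$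 for $s_m\le n\le s_{m+1}-1$, with $s_Q=K+1$ (and $\mathcal{H}_x^n=\{0\}$ for $n<s_0$). Complexity: $\mathcal{C}_{\mathrm{norm}}(\mathcal{A},\epsilon)=\tau(n_J+n_H)+n_G$, with $\tau>0$ a universal constant and $n_J,n_H,n_G$ the total numbers of Jacobian-vector products, Hessian-vector products and gradient evaluations needed to find $\bar x$ with $\|\nabla\Phi(\bar x)\|\le\epsilon$; for an algorithm in the class with parameters $K,Q,T$, $n_J=Q$, $n_H=QT$, $n_G=K$. The statement is asymptotic for small $\epsilon$; $\Omega$ hides a positive constant depending only on the constant in $\beta\le\mathcal{O}(\mu_y)$. *)

theory Defs
  imports "HOL-Analysis.Analysis"
begin

section \<open>Euclidean spaces of variable dimension\<close>

text \<open>
  The dimension of a hard instance grows as the accuracy shrinks, so it has to be quantified inside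
  the statement and cannot be a type. All spaces \<open>\<real>\<^sup>d\<close> are therefore realised as coordinate subspaces
  of one inner product space, the finitely supported real sequences; on each of them
  inner product and norm are the standard ones (lemmas \<open>inner_Rn\<close> and \<open>norm_Rn\<close> below).
\<close>

typedef fin_seq = "{x :: nat \<Rightarrow> real. finite {i. x i \<noteq> 0}}"
  morphisms coord Abs_fin_seq
  by (rule exI[of _ "\<lambda>_. 0"]) simp

lemma finite_support: "finite {i. coord x i \<noteq> 0}"
  using coord[of x] by simp

lemma fin_seq_eqI: "(\<And>i. coord x i = coord y i) \<Longrightarrow> x = y"
  by (metis coord_inject ext)

lemma coord_Abs: "finite {i. v i \<noteq> 0} \<Longrightarrow> coord (Abs_fin_seq v) i = v i"
  by (simp add: Abs_fin_seq_inverse)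

instantiation fin_seq :: real_vector
begin

definition "0 = Abs_fin_seq (\<lambda>_. 0)"
definition "x + y = Abs_fin_seq (\<lambda>i. coord x i + coord y i)"
definition "- x = Abs_fin_seq (\<lambda>i. - coord x i)"
definition "x - y = Abs_fin_seq (\<lambda>i. coord x i - coord y i)"
definition "a *\<^sub>R x = Abs_fin_seq (\<lambda>i. a * coord x i)"

lemma coord_zero [simp]: "coord 0 i = 0"
  unfolding zero_fin_seq_def by (simp add: coord_Abs)

lemma coord_add [simp]: "coord (x + y) i = coord x i + coord y i"
  unfolding plus_fin_seq_def
  by (rule coord_Abs, rule finite_subset[OF _ finite_UnI[OF finite_support finite_support, of x y]]) auto

lemma coord_uminus [simp]: "coord (- x) i = - coord x i"
  unfolding uminus_fin_seq_def
  by (rule coord_Abs, rule finite_subset[OF _ finite_support[of x]]) auto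

lemma coord_diff [simp]: "coord (x - y) i = coord x i - coord y i"
  unfolding minus_fin_seq_def
  by (rule coord_Abs, rule finite_subset[OF _ finite_UnI[OF finite_support finite_support, of x y]]) auto

lemma coord_scaleR [simp]: "coord (a *\<^sub>R x) i = a * coord x i"
  unfolding scaleR_fin_seq_def
  by (rule coord_Abs, rule finite_subset[OF _ finite_support[of x]]) auto

instance
  by standard (auto intro!: fin_seq_eqI simp: algebra_simps)

end

instantiation fin_seq :: real_inner
begin

definition "x \<bullet> y = (\<Sum>i | coord x i \<noteq> 0. coord x i * coord y i)"
definition "norm (x :: fin_seq) = sqrt (x \<bullet> x)"
definition "sgn (x :: fin_seq) = x /\<^sub>R norm x"
definition "dist (x :: fin_seq) y = norm (x - y)"
definition [code del]:
  "(uniformity :: (fin_seq \<times> fin_seq) filter) = (INF e\<in>{0 <..}. principal {(x, y). dist x y < e})"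
definition [code del]:
  "open (U :: fin_seq set) \<longleftrightarrow> (\<forall>x\<in>U. eventually (\<lambda>(x', y). x' = x \<longrightarrow> y \<in> U) uniformity)"

lemma inner_fin_seq_superset:
  assumes "finite A" "{i. coord x i \<noteq> 0} \<subseteq> A"
  shows "x \<bullet> y = (\<Sum>i\<in>A. coord x i * coord y i)"
  unfolding inner_fin_seq_def using assms by (intro sum.mono_neutral_left) auto

instance
proof
  fix x y z :: fin_seq and a :: real
  let ?A = "{i. coord x i \<noteq> 0} \<union> {i. coord y i \<noteq> 0}"
  have fin: "finite ?A" by (simp add: finite_support)
  have ip: "u \<bullet> v = (\<Sum>i\<in>?A. coord u i * coord v i)" if "{i. coord u i \<noteq> 0} \<subseteq> ?A" for u v
    using inner_fin_seq_superset[OF fin that] .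
  show "x \<bullet> y = y \<bullet> x"
    by (subst (1 2) ip) (auto simp: mult.commute)
  show "(x + y) \<bullet> z = x \<bullet> z + y \<bullet> z"
    by (subst (1 2 3) ip) (auto simp: algebra_simps sum.distrib)
  show "(a *\<^sub>R x) \<bullet> y = a * (x \<bullet> y)"
    by (subst (1 2) ip) (auto simp: sum_distrib_left mult.assoc)
  show "0 \<le> x \<bullet> x" unfolding inner_fin_seq_def by (intro sum_nonneg) simp
  show "x \<bullet> x = 0 \<longleftrightarrow> x = 0"
  proof
    assume "x \<bullet> x = 0"
    then have "\<forall>i\<in>{i. coord x i \<noteq> 0}. coord x i * coord x i = 0"
      unfolding inner_fin_seq_def by (subst (asm) sum_nonneg_eq_0_iff) (auto simp: finite_support)
    then show "x = 0" by (intro fin_seq_eqI) auto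
  qed (simp add: inner_fin_seq_def)
qed (auto simp: norm_fin_seq_def sgn_fin_seq_def dist_fin_seq_def
      uniformity_fin_seq_def open_fin_seq_def)

end

definition Rn :: "nat \<Rightarrow> fin_seq set" where
  "Rn d = {x. \<forall>i\<ge>d. coord x i = 0}"

lemma subspace_Rn: "subspace (Rn d)"
  by (auto simp: subspace_def Rn_def)

lemma inner_Rn: "x \<in> Rn d \<Longrightarrow> x \<bullet> y = (\<Sum>i<d. coord x i * coord y i)"
  by (rule inner_fin_seq_superset) (auto simp: Rn_def not_le[symmetric])

lemma norm_Rn: "x \<in> Rn d \<Longrightarrow> norm x = sqrt (\<Sum>i<d. (coord x i)\<^sup>2)"
  by (simp add: norm_fin_seq_def inner_Rn power2_eq_square)

lemma bij_betw_Rn: "bij_betw (\<lambda>x. restrict (coord x) {..<d}) (Rn d) ({..<d} \<rightarrow>\<^sub>E UNIV)"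
proof (rule bij_betwI[where g = "\<lambda>v. Abs_fin_seq (\<lambda>i. if i < d then v i else 0)"])
  have fin: "finite {i. (if i < d then v i else 0) \<noteq> (0::real)}" for v
    by (rule finite_subset[of _ "{..<d}"]) auto
  show "(\<lambda>v. Abs_fin_seq (\<lambda>i. if i < d then v i else 0)) \<in> ({..<d} \<rightarrow>\<^sub>E UNIV) \<rightarrow> Rn d"
    by (auto simp: Rn_def coord_Abs[OF fin])
  show "Abs_fin_seq (\<lambda>i. if i < d then restrict (coord x) {..<d} i else 0) = x"
    if "x \<in> Rn d" for x
    using that by (intro fin_seq_eqI, subst coord_Abs[OF fin]) (auto simp: Rn_def)
  show "restrict (coord (Abs_fin_seq (\<lambda>i. if i < d then v i else 0))) {..<d} = v"
    if "v \<in> {..<d} \<rightarrow>\<^sub>E UNIV" for v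
    using that by (auto simp: fun_eq_iff coord_Abs[OF fin] PiE_def extensional_def)
qed auto


section \<open>Derivatives on a subspace\<close>

text \<open>
  \<open>E\<close>, \<open>X\<close> and \<open>Y\<close> below stand for (sub)spaces \<open>\<real>\<^sup>d\<close>; functions matter only on them.
\<close>

definition grad :: "'a::real_inner set \<Rightarrow> ('a \<Rightarrow> real) \<Rightarrow> 'a \<Rightarrow> 'a" where
  "grad E h x = (THE v. v \<in> E \<and> (h has_derivative (\<lambda>u. u \<bullet> v)) (at x within E))"

lemma grad_eqI:
  assumes E: "subspace E" "x \<in> E" "v \<in> E"
    and v: "(h has_derivative (\<lambda>u. u \<bullet> v)) (at x within E)"
  shows "grad E h x = v"
  unfolding grad_def
proof (rule the_equality)
  fix w assume w: "w \<in> E \<and> (h has_derivative (\<lambda>u. u \<bullet> w)) (at x within E)"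
  define u where "u = w - v"
  have u: "u \<in> E" unfolding u_def using E w by (simp add: subspace_diff)
  have line: "(\<lambda>t::real. x + t *\<^sub>R u) ` UNIV \<subseteq> E"
    using E u by (auto simp: subspace_add subspace_scale)
  have l: "((\<lambda>t::real. x + t *\<^sub>R u) has_derivative (\<lambda>t. t *\<^sub>R u)) (at 0)"
    by (auto intro!: derivative_eq_intros)
  have D: "((\<lambda>t. h (x + t *\<^sub>R u)) has_derivative (\<lambda>t. (t *\<^sub>R u) \<bullet> z)) (at 0)"
    if "(h has_derivative (\<lambda>u. u \<bullet> z)) (at x within E)" for z
    using has_derivative_in_compose[OF l,
        of h "\<lambda>u. u \<bullet> z"] has_derivative_subset[OF that line] by simp
  have "(\<lambda>t::real. (t *\<^sub>R u) \<bullet> w) = (\<lambda>t. (t *\<^sub>R u) \<bullet> v)"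
    using has_derivative_unique[OF D D] w v by blast
  from fun_cong[OF this, of 1] have "u \<bullet> u = 0" by (simp add: u_def inner_diff_right)
  then show "w = v" by (simp add: u_def)
qed (use assms in simp)

definition grad_x :: "'a::real_inner set \<Rightarrow> ('a \<Rightarrow> 'b \<Rightarrow> real) \<Rightarrow> 'a \<Rightarrow> 'b \<Rightarrow> 'a" where
  "grad_x X h x y = grad X (\<lambda>u. h u y) x"

definition grad_y :: "'b::real_inner set \<Rightarrow> ('a \<Rightarrow> 'b \<Rightarrow> real) \<Rightarrow> 'a \<Rightarrow> 'b \<Rightarrow> 'b" where
  "grad_y Y h x y = grad Y (\<lambda>w. h x w) y"

text \<open>
  The matrices \<open>\<nabla>\<^sub>x\<nabla>\<^sub>y g(x,y)\<close> (mapping \<open>Y\<close> to \<open>X\<close>) and \<open>\<nabla>\<^sub>y\<^sup>2 g(x,y)\<close> are represented by their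
  products with a fixed vector \<open>v\<close>, i.e. by the partial gradients of \<open>\<langle>\<nabla>\<^sub>y g, v\<rangle>\<close>:
  the \<open>k\<close>-th entry is \<open>\<Sum>\<^sub>j v\<^sub>j \<partial>\<^sub>k \<partial>\<^bsub>y\<^sub>j\<^esub> g\<close>.
\<close>

definition jac_vec ::
  "'a::real_inner set \<Rightarrow> 'b::real_inner set \<Rightarrow> ('a \<Rightarrow> 'b \<Rightarrow> real) \<Rightarrow> 'a \<Rightarrow> 'b \<Rightarrow> 'b \<Rightarrow> 'a" where
  "jac_vec X Y g x y v = grad_x X (\<lambda>u w. grad_y Y g u w \<bullet> v) x y"

definition hess_vec ::
  "'b::real_inner set \<Rightarrow> ('a \<Rightarrow> 'b \<Rightarrow> real) \<Rightarrow> 'a \<Rightarrow> 'b \<Rightarrow> 'b \<Rightarrow> 'b" where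
  "hess_vec Y g x y v = grad_y Y (\<lambda>u w. grad_y Y g u w \<bullet> v) x y"

text \<open>
  Lipschitz continuity, in operator norm, of a matrix-valued map \<open>M\<close> on \<open>X \<times> Y\<close>; the distance of
  pairs is the Euclidean one.
\<close>

definition matrix_lipschitz ::
  "real \<Rightarrow> 'a::real_inner set \<Rightarrow> 'b::real_inner set \<Rightarrow> ('a \<Rightarrow> 'b \<Rightarrow> 'b \<Rightarrow> 'c::real_inner) \<Rightarrow> bool" where
  "matrix_lipschitz \<rho> X Y M \<longleftrightarrow>
    0 \<le> \<rho> \<and>
    (\<forall>x\<in>X. \<forall>y\<in>Y. \<forall>x'\<in>X. \<forall>y'\<in>Y. \<forall>v\<in>Y.
      norm (M x y v - M x' y' v) \<le> \<rho> * dist (x, y) (x', y') * norm v)"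

definition strongly_convex_on :: "real \<Rightarrow> 'a::real_inner set \<Rightarrow> ('a \<Rightarrow> real) \<Rightarrow> bool" where
  "strongly_convex_on \<mu> E h \<longleftrightarrow>
    convex E \<and>
    (\<forall>x\<in>E. \<forall>y\<in>E. \<forall>t\<in>{0..1}.
      h ((1 - t) *\<^sub>R x + t *\<^sub>R y) \<le> (1 - t) * h x + t * h y - \<mu> / 2 * t * (1 - t) * (norm (x - y))\<^sup>2)"


section \<open>Bilevel problems\<close>

definition lower_solution :: "'b set \<Rightarrow> ('a \<Rightarrow> 'b \<Rightarrow> real) \<Rightarrow> 'a \<Rightarrow> 'b" where
  "lower_solution Y g x = arg_min_on (g x) Y"

definition upper_objective ::
  "'b set \<Rightarrow> ('a \<Rightarrow> 'b \<Rightarrow> real) \<Rightarrow> ('a \<Rightarrow> 'b \<Rightarrow> real) \<Rightarrow> 'a \<Rightarrow> real" where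
  "upper_objective Y f g x = f x (lower_solution Y g x)"

text \<open>
  In \<open>F_csc\<close> the constants \<open>Gxy\<close> and \<open>Gy\<close> are the Lipschitz constants of \<open>\<nabla>\<^sub>y g\<close>
  (usually written \<open>L\<^sub>x\<^sub>y\<close> and \<open>L\<^sub>y\<close> with a tilde).
  Nonnegativity of all Lipschitz constants is part of \<open>lipschitz_on\<close> and \<open>matrix_lipschitz\<close>.
\<close>

definition F_csc ::
  "real \<Rightarrow> real \<Rightarrow> real \<Rightarrow> real \<Rightarrow> real \<Rightarrow> real \<Rightarrow> real \<Rightarrow> real \<Rightarrow> real \<Rightarrow>
   'a::real_inner set \<Rightarrow> 'b::real_inner set \<Rightarrow> ('a \<Rightarrow> 'b \<Rightarrow> real) \<Rightarrow> ('a \<Rightarrow> 'b \<Rightarrow> real) \<Rightarrow> bool" where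
  "F_csc Lx Lxy Ly Gxy Gy \<rho>xy \<rho>yy \<mu>y B X Y f g \<longleftrightarrow>
    (\<lambda>z. f (fst z) (snd z)) differentiable_on (X \<times> Y) \<and>
    (\<lambda>z. g (fst z) (snd z)) differentiable_on (X \<times> Y) \<and>
    (\<lambda>z. grad_y Y g (fst z) (snd z)) differentiable_on (X \<times> Y) \<and>
    (\<forall>y\<in>Y. Lx-lipschitz_on X (\<lambda>x. grad_x X f x y)) \<and>
    (\<forall>x\<in>X. Lxy-lipschitz_on Y (\<lambda>y. grad_x X f x y)) \<and>
    (\<forall>y\<in>Y. Lxy-lipschitz_on X (\<lambda>x. grad_y Y f x y)) \<and>
    (\<forall>x\<in>X. Ly-lipschitz_on Y (\<lambda>y. grad_y Y f x y)) \<and>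
    (\<forall>y\<in>Y. Gxy-lipschitz_on X (\<lambda>x. grad_y Y g x y)) \<and>
    (\<forall>x\<in>X. Gy-lipschitz_on Y (\<lambda>y. grad_y Y g x y)) \<and>
    matrix_lipschitz \<rho>xy X Y (jac_vec X Y g) \<and>
    matrix_lipschitz \<rho>yy X Y (hess_vec Y g) \<and>
    0 < B \<and>
    (\<exists>xs. is_arg_min (upper_objective Y f g) (\<lambda>x. x \<in> X) xs \<and> norm xs = B) \<and>
    convex_on X (upper_objective Y f g) \<and>
    0 < \<mu>y \<and>
    (\<forall>x\<in>X. strongly_convex_on \<mu>y Y (g x))"


section \<open>Hypergradient-based algorithms\<close>

text \<open>
  Vectors that one index \<open>i\<close> contributes to the spans, \<open>A\<close> and \<open>C\<close> being the \<open>x\<close>- and \<open>y\<close>-space at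
  that index. The list \<open>ps\<close> holds the points \<open>(x\<^sub>i\<^sub>,\<^sub>j, y\<^sub>i\<^sub>,\<^sub>j)\<close> of the product of matrices
  \<open>I - \<alpha> \<nabla>\<^sub>y\<^sup>2 g\<close>, leftmost factor first; its length is \<open>t \<le> T\<close>.
\<close>

definition y_gens :: "'b::real_inner set \<Rightarrow> ('a \<Rightarrow> 'b \<Rightarrow> real) \<Rightarrow> 'a set \<Rightarrow> 'b set \<Rightarrow> 'b set" where
  "y_gens Y g A C = C \<union> {grad_y Y g x y |x y. x \<in> A \<and> y \<in> C}"

definition x_gens ::
  "'a::real_inner set \<Rightarrow> 'b::real_inner set \<Rightarrow> ('a \<Rightarrow> 'b \<Rightarrow> real) \<Rightarrow> ('a \<Rightarrow> 'b \<Rightarrow> real) \<Rightarrow>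
   nat \<Rightarrow> 'a set \<Rightarrow> 'b set \<Rightarrow> 'a set" where
  "x_gens X Y f g T A C =
    A \<union> {grad_x X f x y |x y. x \<in> A \<and> y \<in> C} \<union>
    {jac_vec X Y g x y
       (foldr (\<lambda>(u, w) v. v - \<alpha> *\<^sub>R hess_vec Y g u w v) ps (grad_y Y f x' y'))
     |x y ps \<alpha> x' y'. x \<in> A \<and> y \<in> C \<and> set ps \<subseteq> A \<times> C \<and> length ps \<le> T \<and> x' \<in> A \<and> y' \<in> C}"

text \<open>
  The equations below determine \<open>Hx n\<close> and \<open>Hy n\<close> for \<open>n \<le> K\<close> by recursion on \<open>n\<close>. The convention
  \<open>s Q = K + 1\<close> closes the last block, and together with strict monotonicity it forces
  \<open>s m \<le> K\<close> for \<open>m < Q\<close>.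
\<close>

definition hypergradient_spaces ::
  "'a::real_inner set \<Rightarrow> 'b::real_inner set \<Rightarrow> ('a \<Rightarrow> 'b \<Rightarrow> real) \<Rightarrow> ('a \<Rightarrow> 'b \<Rightarrow> real) \<Rightarrow>
   nat \<Rightarrow> nat \<Rightarrow> nat \<Rightarrow> (nat \<Rightarrow> nat) \<Rightarrow> (nat \<Rightarrow> 'a set) \<Rightarrow> (nat \<Rightarrow> 'b set) \<Rightarrow> bool" where
  "hypergradient_spaces X Y f g K Q T s Hx Hy \<longleftrightarrow>
    Hx 0 = {0} \<and> Hy 0 = {0} \<and>
    (\<forall>k<K. Hy (k + 1) = span (\<Union>i\<in>{1..k}. y_gens Y g (Hx i) (Hy i))) \<and>
    (\<forall>n<s 0. Hx n = {0}) \<and>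
    (\<forall>m<Q. Hx (s m) = span (\<Union>i\<in>{1..<s m}. x_gens X Y f g T (Hx i) (Hy i))) \<and>
    (\<forall>m<Q. \<forall>n\<in>{s m..<s (m + 1)}. Hx n = Hx (s m))"

definition hypergradient_based ::
  "'a::real_inner set \<Rightarrow> 'b::real_inner set \<Rightarrow> ('a \<Rightarrow> 'b \<Rightarrow> real) \<Rightarrow> ('a \<Rightarrow> 'b \<Rightarrow> real) \<Rightarrow>
   nat \<Rightarrow> nat \<Rightarrow> nat \<Rightarrow> (nat \<Rightarrow> nat) \<Rightarrow> (nat \<Rightarrow> 'a) \<Rightarrow> (nat \<Rightarrow> 'b) \<Rightarrow> bool" where
  "hypergradient_based X Y f g K Q T s x y \<longleftrightarrow>
    strict_mono_on {..Q} s \<and> s Q = K + 1 \<and>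
    (\<exists>Hx Hy. hypergradient_spaces X Y f g K Q T s Hx Hy \<and> (\<forall>k\<le>K. x k \<in> Hx k \<and> y k \<in> Hy k))"

text \<open>\<open>\<tau> (n\<^sub>J + n\<^sub>H) + n\<^sub>G\<close> with \<open>n\<^sub>J = Q\<close>, \<open>n\<^sub>H = Q T\<close> and \<open>n\<^sub>G = K\<close>\<close>

definition C_norm :: "real \<Rightarrow> nat \<Rightarrow> nat \<Rightarrow> nat \<Rightarrow> real" where
  "C_norm \<tau> K Q T = \<tau> * (real Q + real (Q * T)) + real K"

end

theory Submission
  imports Defs
begin

text \<open>
  Let \<open>D\<close> be the forward difference on \<open>\<real>\<^sup>d\<close> and \<open>e\<^sub>0\<close> the first coordinate vector. The hard instance
  is quadratic: \<open>f(x,y) = L\<^sub>x/8 |D x|\<^sup>2 + L\<^sub>y/2 |y|\<^sup>2 - l \<kappa> \<langle>x, e\<^sub>0\<rangle>\<close> and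
  \<open>g(x,y) = \<mu>/2 |y|\<^sup>2 - G\<^sub>x\<^sub>y/2 \<langle>D x, y\<rangle>\<close>, so \<open>y*(x) = G\<^sub>x\<^sub>y/(2\<mu>) D x\<close> and
  \<open>\<Phi>(x) = \<kappa>/2 |D x|\<^sup>2 - l \<kappa> \<langle>x, e\<^sub>0\<rangle>\<close> with \<open>\<kappa> = (G\<^sub>x\<^sub>y\<^sup>2 L\<^sub>y + L\<^sub>x \<mu>\<^sup>2) / (4 \<mu>\<^sup>2)\<close>; its minimizer is
  \<open>l (d, d - 1, \<dots>, 1)\<close>, of norm \<open>B\<close> for a suitable \<open>l \<ge> B / d\<^bsup>3/2\<^esup>\<close>. Every update of \<open>x\<close>
  lengthens the supports of all iterates by at most one coordinate. As long as the last coordinate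
  vanishes, the gradient of \<open>\<Phi>\<close> has inner product \<open>-\<kappa> l\<close> with the vector of ones, hence norm at
  least \<open>\<kappa> B / d\<^sup>2\<close>. With \<open>d\<close> just below \<open>sqrt (\<kappa> B / \<epsilon>)\<close> this forces \<open>Q \<ge> d\<close>.
\<close>

section \<open>Elementary facts on coordinate subspaces, gradients and squared norms\<close>

lemma Rn_mono: "m \<le> n \<Longrightarrow> Rn m \<subseteq> Rn n"
  by (auto simp: Rn_def)

lemma zero_in_Rn [simp]: "0 \<in> Rn d"
  by (simp add: Rn_def)

text \<open>\<open>grad E\<close> sees only values on \<open>E\<close>. Hence a closed form of
  \<open>grad_y E g\<close> that is known only at points of \<open>E\<close> can be differentiated
  once more.\<close>

lemma grad_cong:
  assumes "\<And>u. u \<in> E \<Longrightarrow> h u = k u" "x \<in> E"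
  shows "grad E h x = grad E k x"
proof -
  have "(h has_derivative D) (at x within E) \<longleftrightarrow> (k has_derivative D) (at x within E)" for D
    using has_derivative_transform[of x E h k D] has_derivative_transform[of x E k h D] assms by auto
  then show ?thesis
    unfolding grad_def by simp
qed

text \<open>The product of factors \<open>I - \<alpha> H\<close> collapses to a scalar power when
  \<open>H\<close> is a multiple of the identity.\<close>

lemma foldr_diff_scaleR:
  fixes v :: "'a::real_vector"
  shows "foldr (\<lambda>_ v. v - a *\<^sub>R v) ps v = (1 - a) ^ length ps *\<^sub>R v"
  by (induction ps) (simp_all add: algebra_simps)

text \<open>Serves both the strong convexity of \<open>g x\<close> and, once the last term is
  dropped, the convexity of \<open>\<Phi>\<close>.\<close>

lemma norm_convex_combination:
  fixes x y :: "'a::real_inner"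
  shows "(norm ((1 - t) *\<^sub>R x + t *\<^sub>R y))\<^sup>2 =
    (1 - t) * (norm x)\<^sup>2 + t * (norm y)\<^sup>2 - t * (1 - t) * (norm (x - y))\<^sup>2"
  by (simp add: power2_norm_eq_inner inner_commute algebra_simps)

section \<open>Truncated difference operators\<close>

text \<open>\<open>trunc 1 (\<lambda>_. 1)\<close> is the first unit vector and
  \<open>trunc d (\<lambda>_. 1)\<close> the vector of ones.\<close>

definition trunc :: "nat \<Rightarrow> (nat \<Rightarrow> real) \<Rightarrow> fin_seq" where
  "trunc d v = Abs_fin_seq (\<lambda>i. if i < d then v i else 0)"

lemma coord_trunc [simp]: "coord (trunc d v) i = (if i < d then v i else 0)"
  unfolding trunc_def by (rule coord_Abs, rule finite_subset[of _ "{..<d}"]) auto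

lemma trunc_in_Rn [simp]: "trunc d v \<in> Rn d"
  by (simp add: Rn_def)

lemma inner_trunc: "trunc d v \<bullet> x = (\<Sum>i<d. v i * coord x i)"
  by (simp add: inner_Rn[OF trunc_in_Rn])

lemma norm_trunc: "norm (trunc d v) = sqrt (\<Sum>i<d. (v i)\<^sup>2)"
  by (simp add: norm_Rn[OF trunc_in_Rn])

text \<open>Here \<open>x\<close> may lie outside \<open>Rn d\<close>, so that the difference
  operators are bounded on the whole space.\<close>

lemma norm_coord_le: "(\<Sum>i<d. (coord x i)\<^sup>2) \<le> (norm x)\<^sup>2"
proof -
  let ?A = "{..<d} \<union> {i. coord x i \<noteq> 0}"
  have fin: "finite ?A" by (simp add: finite_support)
  have "(norm x)\<^sup>2 = (\<Sum>i\<in>?A. (coord x i)\<^sup>2)"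
    unfolding power2_norm_eq_inner
    by (subst inner_fin_seq_superset[OF fin]) (auto simp: power2_eq_square)
  then show ?thesis
    using sum_mono2[of ?A "{..<d}" "\<lambda>i. (coord x i)\<^sup>2"] fin by simp
qed

text \<open>The upper bidiagonal d by d matrix with 1 on the diagonal and -1 above it; the
  coordinate past the end counts as 0.\<close>

definition fdiff :: "nat \<Rightarrow> fin_seq \<Rightarrow> fin_seq" where
  "fdiff d x = trunc d (\<lambda>i. coord x i - (if Suc i < d then coord x (Suc i) else 0))"

text \<open>The transpose of \<open>fdiff d\<close>.\<close>

definition bdiff :: "nat \<Rightarrow> fin_seq \<Rightarrow> fin_seq" where
  "bdiff d x = trunc d (\<lambda>i. coord x i - (if i = 0 then 0 else coord x (i - 1)))"

lemma fdiff_in_Rn [simp]: "fdiff d x \<in> Rn d"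
  and bdiff_in_Rn [simp]: "bdiff d x \<in> Rn d"
  by (simp_all add: fdiff_def bdiff_def)

lemma fdiff_support: "x \<in> Rn m \<Longrightarrow> fdiff d x \<in> Rn m"
  by (simp add: Rn_def fdiff_def)

text \<open>Row \<open>i\<close> reads coordinate \<open>i - 1\<close>, so supports can grow by one.
  In \<open>fdiff\<close>, row \<open>i\<close> reads only \<open>i\<close> and
  \<open>i + 1\<close>, so they do not. This asymmetry drives the lower bound.\<close>

lemma bdiff_support: "x \<in> Rn m \<Longrightarrow> bdiff d x \<in> Rn (Suc m)"
  by (auto simp: Rn_def bdiff_def)

text \<open>Summation by parts; no boundary term survives because the missing neighbour at either
  end counts as 0.\<close>

lemma fdiff_adjoint: "fdiff d x \<bullet> y = x \<bullet> bdiff d y"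
proof (cases d)
  case (Suc n)
  have "(\<Sum>i<Suc n. (if i < n then coord x (Suc i) else 0) * coord y i) =
      (\<Sum>i<n. coord x (Suc i) * coord y i)"
    by simp
  moreover have "(\<Sum>i<Suc n. coord x i * (if i = 0 then 0 else coord y (i - 1))) =
      (\<Sum>i<n. coord x (Suc i) * coord y i)"
    by (subst sum.lessThan_Suc_shift) simp
  ultimately show ?thesis
    unfolding inner_commute[of x] fdiff_def bdiff_def inner_trunc Suc
    by (simp only: left_diff_distrib right_diff_distrib sum_subtractf mult.commute Suc_less_eq)
qed (simp add: fdiff_def bdiff_def inner_trunc inner_commute[of x])

text \<open>By (a - b)^2 \<le> 2 a^2 + 2 b^2, where the shifted coordinates also have square sum at
  most that of \<open>x\<close>.\<close>

lemma norm_fdiff: "norm (fdiff d x) \<le> 2 * norm x"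
proof -
  define b where "b i = (if Suc i < d then coord x (Suc i) else 0)" for i
  have b: "(\<Sum>i<d. (b i)\<^sup>2) \<le> (norm x)\<^sup>2"
  proof (cases d)
    case (Suc n)
    have "(\<Sum>i<d. (b i)\<^sup>2) = (\<Sum>i<n. (coord x (Suc i))\<^sup>2)"
      by (simp add: Suc b_def)
    also have "\<dots> \<le> (\<Sum>i<d. (coord x i)\<^sup>2)"
      unfolding Suc by (subst sum.lessThan_Suc_shift) simp
    finally show ?thesis using norm_coord_le[of x d] by linarith
  qed simp
  have "(norm (fdiff d x))\<^sup>2 = (\<Sum>i<d. (coord x i - b i)\<^sup>2)"
    by (simp add: fdiff_def norm_trunc b_def sum_nonneg)
  also have "\<dots> \<le> (\<Sum>i<d. 2 * (coord x i)\<^sup>2 + 2 * (b i)\<^sup>2)"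
  proof (rule sum_mono)
    fix i
    show "(coord x i - b i)\<^sup>2 \<le> 2 * (coord x i)\<^sup>2 + 2 * (b i)\<^sup>2"
      using zero_le_power2[of "coord x i + b i"] by (simp add: power2_eq_square algebra_simps)
  qed
  also have "\<dots> \<le> (2 * norm x)\<^sup>2"
    using b norm_coord_le[of x d] by (simp add: sum.distrib flip: sum_distrib_left)
  finally show ?thesis
    by (rule power2_le_imp_le) simp
qed

lemma linear_fdiff: "linear (fdiff d)"
  by (rule linearI) (auto intro!: fin_seq_eqI simp: fdiff_def algebra_simps)

lemma linear_bdiff: "linear (bdiff d)"
  by (rule linearI) (auto intro!: fin_seq_eqI simp: bdiff_def algebra_simps)

lemma bounded_linear_fdiff: "bounded_linear (fdiff d)"
  using linear_fdiff norm_fdiff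
  by (metis bounded_linear_axioms.intro bounded_linear.intro mult.commute)

lemmas [derivative_intros] = bounded_linear.has_derivative[OF bounded_linear_fdiff]

lemma has_derivative_norm_power2 [derivative_intros]:
  assumes "(h has_derivative h') (at x within S)"
  shows "((\<lambda>u. (norm (h u))\<^sup>2) has_derivative (\<lambda>u. 2 * (h' u \<bullet> h x))) (at x within S)"
  unfolding power2_norm_eq_inner
  by (rule has_derivative_eq_rhs[OF has_derivative_inner[OF assms assms]])
    (simp add: fun_eq_iff inner_commute)

text \<open>An operator and its adjoint have the same bound: |D* x|^2 = <D D* x, x> \<le> 2 |D* x|
  |x|.\<close>

lemma norm_bdiff: "norm (bdiff d x) \<le> 2 * norm x"
proof -
  have "norm (bdiff d x) * norm (bdiff d x) = fdiff d (bdiff d x) \<bullet> x"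
    by (simp add: fdiff_adjoint power2_norm_eq_inner flip: power2_eq_square)
  also have "\<dots> \<le> norm (fdiff d (bdiff d x)) * norm x"
    by (rule norm_cauchy_schwarz)
  also have "\<dots> \<le> (2 * norm (bdiff d x)) * norm x"
    by (intro mult_right_mono norm_fdiff) simp
  finally have "norm (bdiff d x) * norm (bdiff d x) \<le> norm (bdiff d x) * (2 * norm x)"
    by (simp add: mult_ac)
  then show ?thesis
    by (cases "norm (bdiff d x) = 0") (auto simp: mult_le_cancel_left)
qed

lemma fdiff_ramp: "fdiff d (trunc d (\<lambda>i. real (d - i))) = trunc d (\<lambda>_. 1)"
  by (rule fin_seq_eqI) (auto simp: fdiff_def)

text \<open>With \<open>fdiff_ramp\<close>, the ramp solves D* D z = e_0, which is the stationarity
  equation of \<open>\<Phi>\<close> up to the scale \<open>l\<close>.\<close>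

lemma bdiff_ones: "0 < d \<Longrightarrow> bdiff d (trunc d (\<lambda>_. 1)) = trunc 1 (\<lambda>_. 1)"
  by (rule fin_seq_eqI) (auto simp: bdiff_def)

text \<open>The sum of the backward differences telescopes.\<close>

lemma inner_bdiff_ones: "0 < d \<Longrightarrow> bdiff d y \<bullet> trunc d (\<lambda>_. 1) = coord y (d - 1)"
proof -
  assume "0 < d"
  have "(\<Sum>i<Suc n. coord y i - (if i = 0 then 0 else coord y (i - 1))) = coord y n" for n
    by (induction n) (simp_all add: sum.lessThan_Suc)
  moreover have "bdiff d y \<bullet> trunc d (\<lambda>_. 1) =
      (\<Sum>i<d. coord y i - (if i = 0 then 0 else coord y (i - 1)))"
    unfolding bdiff_def inner_trunc by (rule sum.cong) auto
  ultimately show ?thesis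
    using \<open>0 < d\<close> by (cases d) (simp_all del: sum.lessThan_Suc)
qed

section \<open>The hard instance\<close>

text \<open>The scale \<open>l\<close> of the minimizer stays free here; it is fixed later by
  prescribing the norm \<open>B\<close>.\<close>

locale chain_problem =
  fixes d :: nat and Lx Ly Gxy \<mu> l :: real
  assumes d: "0 < d" and Lx: "0 \<le> Lx" and Ly: "0 \<le> Ly" and Gxy: "0 \<le> Gxy" and \<mu>: "0 < \<mu>"
begin

definition \<kappa> :: real where "\<kappa> = (Gxy\<^sup>2 * Ly + Lx * \<mu>\<^sup>2) / (4 * \<mu>\<^sup>2)"

text \<open>The factor \<open>Lx / 8\<close> compensates |D* D| \<le> 4. The linear term carries
  \<open>\<kappa>\<close> so that the minimizer of \<open>\<Phi>\<close> is the same for every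
  \<open>\<kappa>\<close>.\<close>

definition f :: "fin_seq \<Rightarrow> fin_seq \<Rightarrow> real" where
  "f x y = Lx / 8 * (norm (fdiff d x))\<^sup>2 + Ly / 2 * (norm y)\<^sup>2 - l * \<kappa> * (x \<bullet> trunc 1 (\<lambda>_. 1))"

text \<open>The factor \<open>Gxy / 2\<close> compensates |D| \<le> 2. The Hessian in
  \<open>y\<close> is \<open>\<mu>\<close> times the identity, so Hessian-vector products give no
  new directions.\<close>

definition g :: "fin_seq \<Rightarrow> fin_seq \<Rightarrow> real" where
  "g x y = \<mu> / 2 * (norm y)\<^sup>2 - Gxy / 2 * (fdiff d x \<bullet> y)"

abbreviation "E \<equiv> Rn d"
abbreviation "\<Phi> \<equiv> upper_objective E f g"

lemma kappa_nonneg: "0 \<le> \<kappa>"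
  unfolding \<kappa>_def using Lx Ly by simp

lemmas E_intros = subspace_add[OF subspace_Rn] subspace_diff[OF subspace_Rn]
  subspace_scale[OF subspace_Rn] subspace_neg[OF subspace_Rn]

lemma trunc_1_in_E: "trunc 1 v \<in> E"
  using d Rn_mono[of 1 d] trunc_in_Rn[of 1 v] by auto

section \<open>Closed forms of the oracle answers\<close>

lemma grad_x_f:
  assumes "x \<in> E"
  shows "grad_x E f x y = (Lx / 4) *\<^sub>R bdiff d (fdiff d x) - (l * \<kappa>) *\<^sub>R trunc 1 (\<lambda>_. 1)"
  unfolding grad_x_def f_def
proof (rule grad_eqI[OF subspace_Rn assms])
  show "(Lx / 4) *\<^sub>R bdiff d (fdiff d x) - (l * \<kappa>) *\<^sub>R trunc 1 (\<lambda>_. 1) \<in> E"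
    by (intro E_intros bdiff_in_Rn trunc_1_in_E)
qed (rule derivative_eq_intros refl | simp add: fdiff_adjoint inner_diff_right)+

lemma grad_y_f:
  assumes "y \<in> E"
  shows "grad_y E f x y = Ly *\<^sub>R y"
  unfolding grad_y_def f_def
proof (rule grad_eqI[OF subspace_Rn assms])
  show "Ly *\<^sub>R y \<in> E" by (intro E_intros assms)
qed (rule derivative_eq_intros refl | simp)+

lemma grad_y_g:
  assumes "y \<in> E"
  shows "grad_y E g x y = \<mu> *\<^sub>R y - (Gxy / 2) *\<^sub>R fdiff d x"
  unfolding grad_y_def g_def
proof (rule grad_eqI[OF subspace_Rn assms])
  show "\<mu> *\<^sub>R y - (Gxy / 2) *\<^sub>R fdiff d x \<in> E" by (intro E_intros assms fdiff_in_Rn)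
qed (rule derivative_eq_intros refl | simp add: inner_diff_right inner_commute)+

lemma jac_vec_g:
  assumes "x \<in> E" "y \<in> E"
  shows "jac_vec E E g x y v = - (Gxy / 2) *\<^sub>R bdiff d v"
  unfolding jac_vec_def grad_x_def grad_y_g[OF assms(2)]
proof (rule grad_eqI[OF subspace_Rn assms(1)])
  show "- (Gxy / 2) *\<^sub>R bdiff d v \<in> E" by (intro E_intros bdiff_in_Rn)
qed (rule derivative_eq_intros refl | simp add: inner_diff_left fdiff_adjoint)+

lemma hess_vec_g:
  assumes "y \<in> E" "v \<in> E"
  shows "hess_vec E g x y v = \<mu> *\<^sub>R v"
proof -
  have "hess_vec E g x y v = grad E (\<lambda>w. (\<mu> *\<^sub>R w - (Gxy / 2) *\<^sub>R fdiff d x) \<bullet> v) y"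
    unfolding hess_vec_def grad_y_def[of E "\<lambda>u w. grad_y E g u w \<bullet> v"]
    by (rule grad_cong) (simp_all add: grad_y_g assms)
  also have "\<dots> = \<mu> *\<^sub>R v"
  proof (rule grad_eqI[OF subspace_Rn assms(1)])
    show "\<mu> *\<^sub>R v \<in> E" by (intro E_intros assms)
  qed (rule derivative_eq_intros refl | simp add: inner_diff_left)+
  finally show ?thesis .
qed

section \<open>The lower-level solution and the reduced objective\<close>

lemma g_complete_square:
  "g x y = \<mu> / 2 * (norm (y - (Gxy / (2 * \<mu>)) *\<^sub>R fdiff d x))\<^sup>2
    - \<mu> / 2 * (norm ((Gxy / (2 * \<mu>)) *\<^sub>R fdiff d x))\<^sup>2"
  using \<mu> unfolding g_def power2_norm_eq_inner
  by (simp add: inner_diff_left inner_diff_right inner_commute[of y "fdiff d x"] field_simps)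

lemma lower_solution_g: "lower_solution E g x = (Gxy / (2 * \<mu>)) *\<^sub>R fdiff d x"
proof -
  let ?y = "(Gxy / (2 * \<mu>)) *\<^sub>R fdiff d x"
  have y: "?y \<in> E" by (simp add: E_intros)
  \<comment> \<open>\<open>arg_min\<close> is a choice operator, so the minimizer has to be shown
    unique before its value is determined.\<close>
  have min: "is_arg_min (g x) (\<lambda>y. y \<in> E) z \<longleftrightarrow> z = ?y" for z
  proof
    assume "is_arg_min (g x) (\<lambda>y. y \<in> E) z"
    then have "g x z \<le> g x ?y"
      using y by (auto simp: is_arg_min_linorder)
    then have "(norm (z - ?y))\<^sup>2 \<le> 0"
      using \<mu> unfolding g_complete_square[of x z] g_complete_square[of x ?y]
      by (simp add: mult_le_0_iff)
    then show "z = ?y" by simp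
  next
    assume "z = ?y"
    then show "is_arg_min (g x) (\<lambda>y. y \<in> E) z"
      using \<mu> y unfolding is_arg_min_linorder g_complete_square[of x] by simp
  qed
  show ?thesis
    unfolding lower_solution_def arg_min_on_def arg_min_def min by simp
qed

lemma upper_objective_eq:
  "\<Phi> x = \<kappa> / 2 * (norm (fdiff d x))\<^sup>2 - l * \<kappa> * (x \<bullet> trunc 1 (\<lambda>_. 1))"
proof -
  have "\<kappa> / 2 = Lx / 8 + Ly / 2 * (Gxy / (2 * \<mu>))\<^sup>2"
    using \<mu> by (simp add: \<kappa>_def field_simps power2_eq_square)
  moreover have "(norm ((Gxy / (2 * \<mu>)) *\<^sub>R fdiff d x))\<^sup>2 = (Gxy / (2 * \<mu>))\<^sup>2 * (norm (fdiff d x))\<^sup>2"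
    by (simp only: norm_scaleR power_mult_distrib power2_abs)
  ultimately show ?thesis
    unfolding upper_objective_def lower_solution_g f_def by (simp only:) (simp add: algebra_simps)
qed

text \<open>D* D z = l e_0 turns the linear term of \<open>\<Phi>\<close> into the cross term of a
  square, so \<open>z\<close> is a minimizer.\<close>

lemma upper_objective_complete_square:
  defines "z \<equiv> l *\<^sub>R trunc d (\<lambda>i. real (d - i))"
  shows "\<Phi> x = \<kappa> / 2 * (norm (fdiff d (x - z)))\<^sup>2 - \<kappa> / 2 * (norm (fdiff d z))\<^sup>2"
proof -
  have z: "fdiff d z = l *\<^sub>R trunc d (\<lambda>_. 1)"
    by (simp add: z_def linear_scale[OF linear_fdiff] fdiff_ramp)
  have "fdiff d x \<bullet> fdiff d z = l * (x \<bullet> trunc 1 (\<lambda>_. 1))"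
    by (simp add: z fdiff_adjoint linear_scale[OF linear_bdiff] bdiff_ones d)
  then show ?thesis
    unfolding upper_objective_eq linear_diff[OF linear_fdiff] power2_norm_eq_inner
    by (simp add: inner_diff_left inner_diff_right inner_commute algebra_simps)
qed

lemma grad_upper_objective:
  assumes "x \<in> E"
  shows "grad E \<Phi> x = \<kappa> *\<^sub>R bdiff d (fdiff d x) - (l * \<kappa>) *\<^sub>R trunc 1 (\<lambda>_. 1)"
  unfolding upper_objective_eq[abs_def]
proof (rule grad_eqI[OF subspace_Rn assms])
  show "\<kappa> *\<^sub>R bdiff d (fdiff d x) - (l * \<kappa>) *\<^sub>R trunc 1 (\<lambda>_. 1) \<in> E"
    by (intro E_intros bdiff_in_Rn trunc_1_in_E)
qed (rule derivative_eq_intros refl | simp add: fdiff_adjoint inner_diff_right)+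

text \<open>Test the gradient against the vector of ones: the D* D part contributes the last
  coordinate of \<open>fdiff d x\<close>, which vanishes, and \<open>- (\<kappa> * l)\<close>
  remains. The ones have norm \<open>sqrt d\<close>.\<close>

lemma norm_grad_upper_objective:
  assumes "x \<in> Rn (d - 1)"
  shows "\<kappa> * l \<le> sqrt (real d) * norm (grad E \<Phi> x)"
proof -
  let ?one = "trunc d (\<lambda>_. 1)"
  have x: "x \<in> E" using assms Rn_mono[of "d - 1" d] by auto
  have last: "coord (fdiff d x) (d - Suc 0) = 0"
    using fdiff_support[OF assms] by (simp add: Rn_def)
  have "trunc 1 (\<lambda>_. 1) \<bullet> ?one = 1"
    using d by (simp add: inner_trunc)
  then have "grad E \<Phi> x \<bullet> ?one = - (\<kappa> * l)"
    by (simp add: grad_upper_objective[OF x] inner_diff_left inner_bdiff_ones[OF d] last)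
  moreover have "\<bar>grad E \<Phi> x \<bullet> ?one\<bar> \<le> norm (grad E \<Phi> x) * norm ?one"
    by (rule Cauchy_Schwarz_ineq2)
  ultimately show ?thesis
    by (simp add: norm_trunc mult.commute)
qed

text \<open>All second derivatives are constant and \<open>f\<close> has no mixed term, so any
  nonnegative \<open>Lxy\<close>, \<open>\<rho>xy\<close>, \<open>\<rho>yy\<close> are
  admissible.\<close>

lemma in_F_csc:
  assumes "\<mu> \<le> Gy" "0 \<le> Lxy" "0 \<le> \<rho>xy" "0 \<le> \<rho>yy" "0 < B"
    and l: "l * norm (trunc d (\<lambda>i. real (d - i))) = B"
  shows "F_csc Lx Lxy Ly Gxy Gy \<rho>xy \<rho>yy \<mu> B E E f g"
proof -
  let ?z = "l *\<^sub>R trunc d (\<lambda>i. real (d - i))"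
  have fsub: "fdiff d x - fdiff d x' = fdiff d (x - x')"
    and bsub: "bdiff d x - bdiff d x' = bdiff d (x - x')" for x x'
    by (simp_all add: linear_diff[OF linear_fdiff] linear_diff[OF linear_bdiff])
  have E: "convex E" by (rule subspace_imp_convex[OF subspace_Rn])
  have "(\<lambda>z. f (fst z) (snd z)) differentiable_on (E \<times> E)"
    unfolding differentiable_on_def differentiable_def f_def
    by (intro ballI exI) (rule derivative_intros)+
  moreover have "(\<lambda>z. g (fst z) (snd z)) differentiable_on (E \<times> E)"
    unfolding differentiable_on_def differentiable_def g_def
    by (intro ballI exI) (rule derivative_intros)+
  moreover have "(\<lambda>z. grad_y E g (fst z) (snd z)) differentiable_on (E \<times> E)"
  proof -
    have "(\<lambda>z. \<mu> *\<^sub>R snd z - (Gxy / 2) *\<^sub>R fdiff d (fst z)) differentiable_on (E \<times> E)"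
      unfolding differentiable_on_def differentiable_def
      by (intro ballI exI) (rule derivative_intros)+
    then show ?thesis
      unfolding differentiable_on_def differentiable_def
      using has_derivative_transform[of _ "E \<times> E" "\<lambda>z. grad_y E g (fst z) (snd z)"
          "\<lambda>z. \<mu> *\<^sub>R snd z - (Gxy / 2) *\<^sub>R fdiff d (fst z)"]
      by (fastforce simp: grad_y_g)
  qed
  moreover have "Lx-lipschitz_on E (\<lambda>x. grad_x E f x y)" for y
  proof (rule lipschitz_onI)
    fix x x' assume "x \<in> E" "x' \<in> E"
    then have "dist (grad_x E f x y) (grad_x E f x' y) = Lx / 4 * norm (bdiff d (fdiff d (x - x')))"
      using Lx by (simp add: grad_x_f dist_norm fsub bsub flip: scaleR_diff_right)
    also have "\<dots> \<le> Lx / 4 * (2 * (2 * norm (x - x')))"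
      using Lx by (intro mult_left_mono order_trans[OF norm_bdiff] norm_fdiff) auto
    finally show "dist (grad_x E f x y) (grad_x E f x' y) \<le> Lx * dist x x'"
      by (simp add: dist_norm)
  qed (rule Lx)
  moreover have "Lxy-lipschitz_on E (\<lambda>y. grad_x E f x y)" if "x \<in> E" for x
    by (rule lipschitz_onI) (simp_all add: grad_x_f that assms)
  moreover have "Lxy-lipschitz_on E (\<lambda>x. grad_y E f x y)" if "y \<in> E" for y
    by (rule lipschitz_onI) (simp_all add: grad_y_f that assms)
  moreover have "Ly-lipschitz_on E (\<lambda>y. grad_y E f x y)" for x
    by (rule lipschitz_onI) (simp_all add: grad_y_f Ly dist_norm flip: scaleR_diff_right)
  moreover have "Gxy-lipschitz_on E (\<lambda>x. grad_y E g x y)" if "y \<in> E" for y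
  proof (rule lipschitz_onI)
    fix x x'
    have "dist (grad_y E g x y) (grad_y E g x' y) = Gxy / 2 * norm (fdiff d (x' - x))"
      using Gxy by (simp add: grad_y_g that dist_norm fsub flip: scaleR_diff_right)
    also have "\<dots> \<le> Gxy / 2 * (2 * norm (x' - x))"
      using Gxy by (intro mult_left_mono norm_fdiff) auto
    finally show "dist (grad_y E g x y) (grad_y E g x' y) \<le> Gxy * dist x x'"
      by (simp add: dist_norm norm_minus_commute)
  qed (rule Gxy)
  moreover have "Gy-lipschitz_on E (\<lambda>y. grad_y E g x y)" for x
    using \<mu> assms(1)
    by (intro lipschitz_onI)
      (simp_all add: grad_y_g dist_norm mult_right_mono flip: scaleR_diff_right)
  moreover have "matrix_lipschitz \<rho>xy E E (jac_vec E E g)" "matrix_lipschitz \<rho>yy E E (hess_vec E g)"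
    using assms by (auto simp: matrix_lipschitz_def jac_vec_g hess_vec_g)
  moreover have "is_arg_min \<Phi> (\<lambda>x. x \<in> E) ?z"
    using kappa_nonneg
    by (simp add: is_arg_min_linorder upper_objective_complete_square E_intros
        linear_0[OF linear_fdiff])
  moreover have "norm ?z = B"
  proof -
    \<comment> \<open>The sign is needed to replace the absolute value of \<open>l\<close> in the
      norm of \<open>?z\<close> by \<open>l\<close>.\<close>
    have "0 \<le> l"
      using l \<open>0 < B\<close> by (metis norm_ge_zero not_le order_less_imp_le zero_less_mult_pos2 zero_less_mult_iff)
    then show ?thesis using l by simp
  qed
  moreover have "convex_on E \<Phi>"
  proof (rule convex_onI[OF _ E])
    fix t :: real and x y assume t: "0 < t" "t < 1"
    have "(norm (fdiff d ((1 - t) *\<^sub>R x + t *\<^sub>R y)))\<^sup>2 \<le>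
        (1 - t) * (norm (fdiff d x))\<^sup>2 + t * (norm (fdiff d y))\<^sup>2"
      unfolding linear_add[OF linear_fdiff] linear_scale[OF linear_fdiff] norm_convex_combination
      using t by simp
    from mult_left_mono[OF this, of "\<kappa> / 2"] kappa_nonneg
    show "\<Phi> ((1 - t) *\<^sub>R x + t *\<^sub>R y) \<le> (1 - t) * \<Phi> x + t * \<Phi> y"
      unfolding upper_objective_eq inner_add_left inner_scaleR_left by (simp add: field_simps)
  qed
  moreover have "strongly_convex_on \<mu> E (g x)" for x
    unfolding strongly_convex_on_def g_def norm_convex_combination inner_add_right inner_scaleR_right
    by (auto simp: E field_simps)
  ultimately show ?thesis
    unfolding F_csc_def using \<open>0 < B\<close> \<mu> by blast
qed

section \<open>Growth of the supports\<close>

text \<open>The \<open>y\<close>-oracle applies only \<open>fdiff\<close>. The bound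
  \<open>m \<le> d\<close> keeps all query points in \<open>E\<close>, where the closed forms
  hold.\<close>

lemma y_gens_support:
  assumes "m \<le> d" "A \<subseteq> Rn m" "C \<subseteq> Rn m"
  shows "y_gens E g A C \<subseteq> Rn m"
  using assms Rn_mono[OF assms(1)]
  by (auto simp: y_gens_def grad_y_g subset_iff intro!: E_intros fdiff_support)

text \<open>Each new generator involves \<open>bdiff\<close> at most once, after operations that
  keep the support, plus possibly the first unit vector.\<close>

lemma x_gens_support:
  assumes m: "m \<le> d" and A: "A \<subseteq> Rn m" and C: "C \<subseteq> Rn m"
  shows "x_gens E E f g T A C \<subseteq> Rn (Suc m)"
proof -
  have Em: "Rn m \<subseteq> E" using m by (rule Rn_mono)
  have "A \<subseteq> Rn (Suc m)" using A Rn_mono[of m "Suc m"] by auto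
  moreover have "grad_x E f x y \<in> Rn (Suc m)" if "x \<in> A" for x y
  proof -
    have "trunc 1 (\<lambda>_. 1) \<in> Rn (Suc m)"
      using Rn_mono[of 1 "Suc m"] trunc_in_Rn[of 1] by auto
    then show ?thesis
      using that A Em by (auto simp: grad_x_f subset_iff intro!: E_intros bdiff_support fdiff_support)
  qed
  moreover have "jac_vec E E g x y
      (foldr (\<lambda>(u, w) v. v - \<alpha> *\<^sub>R hess_vec E g u w v) ps (grad_y E f x' y')) \<in> Rn (Suc m)"
    if xy: "x \<in> A" "y \<in> C" "set ps \<subseteq> A \<times> C" "y' \<in> C" for x y ps \<alpha> x' y'
  proof -
    \<comment> \<open>The closed form of \<open>hess_vec\<close> holds for vectors of
      \<open>E\<close>, so the induction must keep every partial product in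
      \<open>E\<close>.\<close>
    have "foldr (\<lambda>(u, w) v. v - \<alpha> *\<^sub>R hess_vec E g u w v) ps v =
        foldr (\<lambda>_ v. v - (\<alpha> * \<mu>) *\<^sub>R v) ps v" if "v \<in> E" for v
      using \<open>set ps \<subseteq> A \<times> C\<close>
    proof (induction ps)
      case (Cons p ps)
      then have "snd p \<in> E" using C Em by auto
      moreover have "foldr (\<lambda>_ v. v - (\<alpha> * \<mu>) *\<^sub>R v) ps v \<in> E"
        unfolding foldr_diff_scaleR by (intro E_intros that)
      ultimately show ?case
        using Cons by (simp add: split_beta hess_vec_g)
    qed simp
    moreover have "y' \<in> Rn m" "x \<in> E" "y \<in> E" "y' \<in> E" using xy A C Em by auto
    moreover from this have "Ly *\<^sub>R y' \<in> E" by (intro E_intros)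
    ultimately show ?thesis
      by (auto simp: grad_y_f jac_vec_g foldr_diff_scaleR intro!: E_intros bdiff_support)
  qed
  ultimately show ?thesis
    unfolding x_gens_def by auto
qed

text \<open>However many \<open>y\<close>-steps are made, the \<open>y\<close>-spaces stay within
  the support already reached by the \<open>x\<close>-spaces. Strong induction is used because a
  span draws on all earlier indices.\<close>

lemma y_spaces_support:
  fixes Hx Hy :: "nat \<Rightarrow> fin_seq set"
  assumes "Hy 0 = {0}" "\<forall>k<K. Hy (k + 1) = span (\<Union>i\<in>{1..k}. y_gens E g (Hx i) (Hy i))"
    and m: "m \<le> d" and Hx: "\<And>i. i < N \<Longrightarrow> Hx i \<subseteq> Rn m"
  shows "n < N \<Longrightarrow> n \<le> K \<Longrightarrow> Hy n \<subseteq> Rn m"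
proof (induction n rule: less_induct)
  case (less n)
  show ?case
  proof (cases n)
    case (Suc k)
    have "span (\<Union>i\<in>{1..k}. y_gens E g (Hx i) (Hy i)) \<subseteq> Rn m"
    proof (rule span_minimal[OF UN_least subspace_Rn])
      fix i assume "i \<in> {1..k}"
      then show "y_gens E g (Hx i) (Hy i) \<subseteq> Rn m"
        using less.prems Suc by (intro y_gens_support m Hx less.IH) auto
    qed
    then show ?thesis using assms(2) less.prems Suc by auto
  qed (simp add: assms)
qed

text \<open>Since the Hessian is a multiple of the identity, Hessian-vector products never enlarge a
  support, and each block of the schedule adds a single coordinate.\<close>

lemma spaces_support:
  assumes H: "hypergradient_spaces E E f g K Q T s Hx Hy"
    and s: "strict_mono_on {..Q} s" "s Q = K + 1" and Q: "Q \<le> d"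
  shows "m \<le> Q \<Longrightarrow> n < s m \<Longrightarrow> Hx n \<subseteq> Rn m \<and> Hy n \<subseteq> Rn m"
proof (induction m arbitrary: n)
  \<comment> \<open>Hence every index below \<open>s m\<close> is at most \<open>K\<close>, the
    range in which the recursion for \<open>Hy\<close> is available.\<close>
  have "s m \<le> K + 1" if "m \<le> Q" for m
    using that s strict_mono_on_leD[OF s(1), of m Q] by auto
  then have Hy: "Hy n \<subseteq> Rn m" if "m \<le> Q" "n < s m" "\<And>i. i < s m \<Longrightarrow> Hx i \<subseteq> Rn m" for n m
    using y_spaces_support[of Hy K Hx m "s m" n] that Q H
    by (fastforce simp: hypergradient_spaces_def)
  {
    case (0 n)
    have "Hx i \<subseteq> Rn 0" if "i < s 0" for i
      using H that by (auto simp: hypergradient_spaces_def)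
    with Hy[of 0 n] 0 show ?case by blast
  next
    case (Suc m n)
    have "Hx (s m) = span (\<Union>i\<in>{1..<s m}. x_gens E E f g T (Hx i) (Hy i))"
      using H Suc.prems by (simp add: hypergradient_spaces_def)
    also have "\<dots> \<subseteq> Rn (Suc m)"
    proof (rule span_minimal[OF UN_least subspace_Rn])
      fix i assume "i \<in> {1..<s m}"
      then show "x_gens E E f g T (Hx i) (Hy i) \<subseteq> Rn (Suc m)"
        using Suc.IH[of i] Suc.prems Q by (intro x_gens_support) auto
    qed
    finally have new: "Hx (s m) \<subseteq> Rn (Suc m)" .
    have "Hx i \<subseteq> Rn (Suc m)" if "i < s (Suc m)" for i
    proof (cases "i < s m")
      case True
      then show ?thesis using Suc.IH[of i] Suc.prems Rn_mono[of m "Suc m"] by auto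
    next
      case False
      have "\<forall>m<Q. \<forall>n\<in>{s m..<s (m + 1)}. Hx n = Hx (s m)"
        using H unfolding hypergradient_spaces_def by blast
      with False have "Hx i = Hx (s m)"
        using Suc.prems that by auto
      with new show ?thesis by simp
    qed
    with Hy[of "Suc m" n] Suc.prems show ?case by blast
  }
qed

lemma updates_ge_dimension:
  assumes alg: "hypergradient_based E E f g K Q T s x y"
    and \<epsilon>: "norm (grad E \<Phi> (x K)) \<le> \<epsilon>" "sqrt (real d) * \<epsilon> < \<kappa> * l"
  shows "d \<le> Q"
proof (rule ccontr)
  assume "\<not> d \<le> Q"
  then have Q: "Q \<le> d" "Q \<le> d - 1" by auto
  obtain Hx Hy where "hypergradient_spaces E E f g K Q T s Hx Hy" "strict_mono_on {..Q} s"
      "s Q = K + 1" "x K \<in> Hx K"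
    using alg by (auto simp: hypergradient_based_def)
  \<comment> \<open>Since \<open>K < s Q\<close>, the support bound applies with
    \<open>m = Q\<close> and \<open>n = K\<close>.\<close>
  then have "x K \<in> Rn (d - 1)"
    using spaces_support[of K Q T s Hx Hy Q K] Q Rn_mono[OF Q(2)] by auto
  then have "\<kappa> * l \<le> sqrt (real d) * norm (grad E \<Phi> (x K))"
    by (rule norm_grad_upper_objective)
  also have "\<dots> \<le> sqrt (real d) * \<epsilon>"
    using \<epsilon> by (intro mult_left_mono) auto
  finally show False using \<epsilon> by simp
qed

end

section \<open>Choice of scale and dimension\<close>

lemma norm_ramp_le: "norm (trunc d (\<lambda>i. real (d - i))) \<le> sqrt (real d) * real d"
proof -
  have "(\<Sum>i<d. (real (d - i))\<^sup>2) \<le> (\<Sum>i<d. (real d)\<^sup>2)"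
    by (intro sum_mono power_mono) auto
  then have "norm (trunc d (\<lambda>i. real (d - i))) \<le> sqrt (real d * (real d)\<^sup>2)"
    by (simp add: norm_trunc)
  then show ?thesis by (simp add: real_sqrt_mult)
qed

text \<open>For \<open>\<kappa> = 0\<close> the claimed bound is 0, but a member of the class still
  has to be supplied, so this case is carried along.\<close>

lemma hard_instance:
  fixes Lx Lxy Ly Gxy Gy \<rho>xy \<rho>yy \<mu> B \<epsilon> :: real
  defines "\<kappa> \<equiv> (Gxy\<^sup>2 * Ly + Lx * \<mu>\<^sup>2) / (4 * \<mu>\<^sup>2)"
  assumes nonneg: "0 \<le> Lx" "0 \<le> Lxy" "0 \<le> Ly" "0 \<le> Gxy" "0 \<le> \<rho>xy" "0 \<le> \<rho>yy"
    and pos: "0 < \<mu>" "\<mu> \<le> Gy" "0 < B" "0 < d" and \<epsilon>: "(real d)\<^sup>2 * \<epsilon> < \<kappa> * B \<or> \<kappa> = 0"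
  obtains f g where "F_csc Lx Lxy Ly Gxy Gy \<rho>xy \<rho>yy \<mu> B (Rn d) (Rn d) f g"
    and "\<And>K Q T s x y. hypergradient_based (Rn d) (Rn d) f g K Q T s x y \<Longrightarrow>
      norm (grad (Rn d) (upper_objective (Rn d) f g) (x K)) \<le> \<epsilon> \<Longrightarrow> d \<le> Q \<or> \<kappa> = 0"
proof -
  define w where "w = norm (trunc d (\<lambda>i. real (d - i)))"
  have "coord (trunc d (\<lambda>i. real (d - i))) 0 \<noteq> 0" using pos by simp
  then have w: "0 < w" unfolding w_def by (metis coord_zero zero_less_norm_iff)
  \<comment> \<open>The scale \<open>B / w\<close> gives the minimizer norm
    \<open>B\<close>.\<close>
  interpret P: chain_problem d Lx Ly Gxy \<mu> "B / w"
    by unfold_locales (use nonneg pos in auto)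
  have \<kappa>: "P.\<kappa> = \<kappa>" by (simp add: P.\<kappa>_def \<kappa>_def)
  have "sqrt (real d) * \<epsilon> < \<kappa> * (B / w)" if "\<kappa> \<noteq> 0"
  proof (cases "0 \<le> \<epsilon>")
    case True
    have "sqrt (real d) * \<epsilon> * w \<le> sqrt (real d) * \<epsilon> * (sqrt (real d) * real d)"
      unfolding w_def using True by (intro mult_left_mono norm_ramp_le) auto
    also have "\<dots> = (real d)\<^sup>2 * \<epsilon>"
      by (simp add: power2_eq_square)
    also have "\<dots> < \<kappa> * B" using \<epsilon> that by simp
    finally show ?thesis using w by (simp add: field_simps)
  next
    case False
    then have "sqrt (real d) * \<epsilon> < 0" using pos by (simp add: mult_pos_neg)
    also have "0 \<le> \<kappa> * (B / w)" using P.kappa_nonneg pos w by (simp add: \<kappa>)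
    finally show ?thesis .
  qed
  then have "d \<le> Q \<or> \<kappa> = 0"
    if "hypergradient_based (Rn d) (Rn d) P.f P.g K Q T s x y"
      "norm (grad (Rn d) (upper_objective (Rn d) P.f P.g) (x K)) \<le> \<epsilon>" for K Q T s x y
    using P.updates_ge_dimension[OF that] by (auto simp: \<kappa>)
  moreover have "F_csc Lx Lxy Ly Gxy Gy \<rho>xy \<rho>yy \<mu> B (Rn d) (Rn d) P.f P.g"
    using nonneg pos w by (intro P.in_F_csc) (auto simp flip: w_def)
  ultimately show ?thesis using that by blast
qed

theorem corollary3:
  fixes \<tau> C :: real
  assumes "\<tau> > 0"
  shows "\<exists>c>0. \<forall>Lx Lxy Ly Gxy Gy \<rho>xy \<rho>yy \<mu>y B :: real.
    Lx \<ge> 0 \<longrightarrow> Lxy \<ge> 0 \<longrightarrow> Ly \<ge> 0 \<longrightarrow> Gxy \<ge> 0 \<longrightarrow> \<rho>xy \<ge> 0 \<longrightarrow> \<rho>yy \<ge> 0 \<longrightarrow>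
    \<mu>y > 0 \<longrightarrow> Gy \<ge> \<mu>y \<longrightarrow> B > 0 \<longrightarrow>
    (let \<beta> = (Gy - \<mu>y) / 4 in \<beta> \<le> C * \<mu>y \<longrightarrow>
      (\<forall>\<^sub>F \<epsilon> in at_right 0.
        \<exists>d f g. F_csc Lx Lxy Ly Gxy Gy \<rho>xy \<rho>yy \<mu>y B (Rn d) (Rn d) f g \<and>
          (\<forall>K Q T s x y. hypergradient_based (Rn d) (Rn d) f g K Q T s x y \<longrightarrow>
             norm (grad (Rn d) (upper_objective (Rn d) f g) (x K)) \<le> \<epsilon> \<longrightarrow>
             C_norm \<tau> K Q T \<ge>
               c * (B powr (1/2) * (Gxy\<^sup>2 * Ly + Lx * \<mu>y\<^sup>2) powr (1/2) / (\<mu>y * \<epsilon> powr (1/2))))))"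
\<comment> \<open>With r = sqrt (\<kappa> B / \<epsilon>) the rate equals 2 r. For
  \<open>\<kappa>\<close> nonzero, r \<le> 2 d \<le> 2 Q, so \<open>\<tau> / 4\<close> times the
  rate is at most \<open>\<tau> * Q\<close>, the Jacobian part of the cost.\<close>
proof (intro exI[of _ "\<tau> / 4"] conjI allI impI)
  fix Lx Lxy Ly Gxy Gy \<rho>xy \<rho>yy \<mu>y B :: real
  assume nonneg: "0 \<le> Lx" "0 \<le> Lxy" "0 \<le> Ly" "0 \<le> Gxy" "0 \<le> \<rho>xy" "0 \<le> \<rho>yy"
    and pos: "0 < \<mu>y" "\<mu>y \<le> Gy" "0 < B"
  define S where "S = Gxy\<^sup>2 * Ly + Lx * \<mu>y\<^sup>2"
  define \<kappa> where "\<kappa> = S / (4 * \<mu>y\<^sup>2)"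
  have S: "0 \<le> S" using nonneg by (simp add: S_def)
  then have \<kappa>: "0 \<le> \<kappa>" by (simp add: \<kappa>_def)
  have "\<exists>d f g. F_csc Lx Lxy Ly Gxy Gy \<rho>xy \<rho>yy \<mu>y B (Rn d) (Rn d) f g \<and>
      (\<forall>K Q T s x y. hypergradient_based (Rn d) (Rn d) f g K Q T s x y \<longrightarrow>
        norm (grad (Rn d) (upper_objective (Rn d) f g) (x K)) \<le> \<epsilon> \<longrightarrow>
        C_norm \<tau> K Q T \<ge> \<tau> / 4 * (B powr (1/2) * S powr (1/2) / (\<mu>y * \<epsilon> powr (1/2))))"
    if \<epsilon>: "0 < \<epsilon>" "\<kappa> = 0 \<or> \<epsilon> < \<kappa> * B / 4" for \<epsilon>
  proof -
    define r where "r = sqrt (\<kappa> * B / \<epsilon>)"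
    have r: "B powr (1/2) * S powr (1/2) / (\<mu>y * \<epsilon> powr (1/2)) = 2 * r"
    proof -
      have "S = \<kappa> * (2 * \<mu>y)\<^sup>2"
        using pos by (simp add: \<kappa>_def power2_eq_square)
      then have "sqrt S = sqrt \<kappa> * (2 * \<mu>y)"
        using pos by (simp add: real_sqrt_mult)
      then show ?thesis
        using pos \<epsilon> S by (simp add: r_def powr_half_sqrt real_sqrt_mult real_sqrt_divide)
    qed
    obtain d where d: "0 < d" "(real d)\<^sup>2 * \<epsilon> < \<kappa> * B \<or> \<kappa> = 0" "r \<le> 2 * real d"
    proof (cases "\<kappa> = 0")
      case True
      then show ?thesis by (intro that[of 1]) (auto simp: r_def)
    next
      case False
      \<comment> \<open>The largest integer strictly below \<open>r\<close>: strictness gives d^2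
        \<epsilon> < \<kappa> B, and the bound on \<open>\<epsilon>\<close> gives
        \<open>2 < r\<close>, so that r \<le> d + 1 \<le> 2 d.\<close>
      define d where "d = nat \<lceil>r\<rceil> - 1"
      have "4 < \<kappa> * B / \<epsilon>" using \<epsilon> False by (simp add: field_simps)
      then have "2 < r" using real_less_rsqrt[of 2] by (simp add: r_def)
      then have *: "real d < r" "r \<le> real d + 1" unfolding d_def by linarith+
      then have "(real d)\<^sup>2 < r\<^sup>2" by (intro power_strict_mono) auto
      then have "(real d)\<^sup>2 * \<epsilon> < \<kappa> * B"
        using \<epsilon> \<kappa> pos by (simp add: r_def field_simps)
      then show ?thesis using * \<open>2 < r\<close> by (intro that[of d]) auto
    qed
    obtain f g where F: "F_csc Lx Lxy Ly Gxy Gy \<rho>xy \<rho>yy \<mu>y B (Rn d) (Rn d) f g"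
      and Q: "\<And>K Q T s x y. hypergradient_based (Rn d) (Rn d) f g K Q T s x y \<Longrightarrow>
        norm (grad (Rn d) (upper_objective (Rn d) f g) (x K)) \<le> \<epsilon> \<Longrightarrow> d \<le> Q \<or> \<kappa> = 0"
      using hard_instance[OF nonneg pos d(1) d(2)[unfolded \<kappa>_def S_def]]
      unfolding \<kappa>_def S_def by metis
    have "\<tau> / 4 * (2 * r) \<le> C_norm \<tau> K Q T" if "d \<le> Q \<or> \<kappa> = 0" for K Q T
    proof -
      have "r \<le> 2 * real Q"
        using that d(3) by (auto simp: r_def)
      then have "\<tau> * r \<le> \<tau> * (2 * real Q)"
        using assms by (intro mult_left_mono) auto
      moreover have "0 \<le> \<tau> * real (Q * T)" using assms by simp
      ultimately show ?thesis
        unfolding C_norm_def by (simp add: algebra_simps)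
    qed
    with F Q show ?thesis unfolding r by blast
  qed
  then have ev: "\<forall>\<^sub>F \<epsilon> in at_right 0. \<exists>d f g. F_csc Lx Lxy Ly Gxy Gy \<rho>xy \<rho>yy \<mu>y B (Rn d) (Rn d) f g \<and>
      (\<forall>K Q T s x y. hypergradient_based (Rn d) (Rn d) f g K Q T s x y \<longrightarrow>
        norm (grad (Rn d) (upper_objective (Rn d) f g) (x K)) \<le> \<epsilon> \<longrightarrow>
        C_norm \<tau> K Q T \<ge> \<tau> / 4 * (B powr (1/2) * S powr (1/2) / (\<mu>y * \<epsilon> powr (1/2))))"
    using \<kappa> pos
    by (intro eventually_at_rightI[of 0 "if \<kappa> = 0 then 1 else \<kappa> * B / 4"]) (auto split: if_splits)
  then show "let \<beta> = (Gy - \<mu>y) / 4 in \<beta> \<le> C * \<mu>y \<longrightarrow>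
      (\<forall>\<^sub>F \<epsilon> in at_right 0.
        \<exists>d f g. F_csc Lx Lxy Ly Gxy Gy \<rho>xy \<rho>yy \<mu>y B (Rn d) (Rn d) f g \<and>
          (\<forall>K Q T s x y. hypergradient_based (Rn d) (Rn d) f g K Q T s x y \<longrightarrow>
             norm (grad (Rn d) (upper_objective (Rn d) f g) (x K)) \<le> \<epsilon> \<longrightarrow>
             C_norm \<tau> K Q T \<ge>
               \<tau> / 4 * (B powr (1/2) * (Gxy\<^sup>2 * Ly + Lx * \<mu>y\<^sup>2) powr (1/2) / (\<mu>y * \<epsilon> powr (1/2)))))"
    by (simp add: S_def Let_def)
qed (use assms in simp)

end
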